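(* Let $t\ge1$, $s>0$, $p\in(0,1)$, let $R_{N(1)}(t)=\sum_{j=1}^{N(1)}\mu(t-V_j)$ be the random sum described in the context, and let $G_{t,t+s}(z_1,z_2)=E[z_1^{R_{N(1)}(t)}z_2^{R_{N(1)}(t+s)}]$, $G_{R_{N(1)}(t)}(z)=E[z^{R_{N(1)}(t)}]$. For $j=0,1,2$ let $$H_j(z_1)=\int_0^1\frac{\Gamma(\mu(t+s-v)+1)}{\Gamma(\mu(t+s-v)+1-j)}\,z_1^{\mu(t-v)}\,\Lambda(\mathrm{d}v).$$ Let $G^{(k,\ell)}_{t,t+s}(p,1)$ be the $(k,\ell)$-th partial derivative of $G_{t,t+s}(z_1,z_2)$ at $(z_1,z_2)=(p,1)$ and $H_j^{(k)}(p)$ the $k$-th derivative of $H_j(z_1)$ at $z_1=p$. Then for $\ell=1,2,\ldots$ and $j=0,1,2$, $$H_j^{(\ell)}(p)=\int_0^1\frac{\Gamma(\mu(t+s-v)+1)}{\Gamma(\mu(t+s-v)+1-j)}\,\frac{\Gamma(\mu(t-v)+1)}{\Gamma(\mu(t-v)+1-\ell)}\,p^{\mu(t-v)-\ell}\,\Lambda(\mathrm{d}v),$$ and $$G^{(\ell,0)}_{t,t+s}(p,1)=\sum_{k=0}^{\ell-1}\binom{\ell-1}{k}G^{(k)}_{R_{N(1)}(t)}(p)\,H_0^{(\ell-k)}(p),$$ $$G^{(\ell,1)}_{t,t+s}(p,1)=\sum_{k=0}^{\ell}\binom{\ell}{k}G^{(k)}_{R_{N(1)}(t)}(p)\,H_1^{(\ell-k)}(p),$$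 $$G^{(\ell,2)}_{t,t+s}(p,1)=\sum_{k=0}^{\ell}\binom{\ell}{k}\Big\{G^{(k,1)}_{t,t+s}(p,1)\,H_1^{(\ell-k)}(p)+G^{(k)}_{R_{N(1)}(t)}(p)\,H_2^{(\ell-k)}(p)\Big\}.$$
   Context: $N$ is a non-homogeneous Poisson process on $[0,\infty)$ with locally finite mean measure $\Lambda$ and $\Lambda(1):=\Lambda[0,1]\in(0,\infty)$, so $N(1)$ is Poisson with mean $\Lambda(1)$. The function $\mu$ is continuous and nondecreasing on $[0,\infty)$ with $\mu(0)=0$ and $\mu(t)>0$ for $t>0$. $(V_j)$ is i.i.d. with distribution $\Lambda(\mathrm{d}x)/\Lambda(1)$ on $[0,1]$, independent of $N$, and $R_{N(1)}(t)=\sum_{j=1}^{N(1)}\mu(t-V_j)$ for $t\ge1$. A superscript $(k,\ell)$ denotes $k$ derivatives in $z_1$ and $\ell$ in $z_2$; a superscript $(0)$ means no differentiation. $\Gamma$ is the Gamma function, with the convention $1/\Gamma=0$ at its poles (so $\Gamma(a+1)/\Gamma(a+1-j)=a(a-1)\cdots(a-j+1)$). *)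

theory Defs
  imports "HOL-Probability.Probability"
begin

(* The library's poisson_pmf is only specified for a positive rate. *)
definition poisson_law :: "real \<Rightarrow> nat pmf" where
  "poisson_law r = (if r = 0 then return_pmf 0 else poisson_pmf r)"

(* A measure on [0,\<infinity>) is represented as a Borel measure on the real line that gives no mass
   to the negative half-line. *)
definition locally_finite_on_half_line :: "real measure \<Rightarrow> bool" where
  "locally_finite_on_half_line \<Lambda> \<longleftrightarrow>
     sets \<Lambda> = sets borel \<and> emeasure \<Lambda> {..<0} = 0 \<and> (\<forall>b\<ge>0. emeasure \<Lambda> {0..b} < \<infinity>)"

(* N t is the number of points in [0,t]. The mean measure may have atoms, possibly at 0, so that
   N 0 need not vanish; it is treated as the first of the independent increments. *)
definition poisson_process ::
    "'a measure \<Rightarrow> real measure \<Rightarrow> (real \<Rightarrow> 'a \<Rightarrow> nat) \<Rightarrow> bool" where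
  "poisson_process M \<Lambda> N \<longleftrightarrow>
     (\<forall>t\<ge>0. N t \<in> measurable M (count_space UNIV)) \<and>
     (\<forall>\<omega>\<in>space M. mono_on {0..} (\<lambda>t. N t \<omega>)) \<and>
     (\<forall>\<omega>\<in>space M. \<forall>t\<ge>0. ((\<lambda>u. N u \<omega>) \<longlongrightarrow> N t \<omega>) (at_right t)) \<and>
     (\<forall>t\<ge>0. distr M (count_space UNIV) (N t)
              = measure_pmf (poisson_law (measure \<Lambda> {0..t}))) \<and>
     (\<forall>r t. 0 \<le> r \<and> r < t \<longrightarrow>
        distr M (count_space UNIV) (\<lambda>\<omega>. N t \<omega> - N r \<omega>)
          = measure_pmf (poisson_law (measure \<Lambda> {r<..t}))) \<and>
     (\<forall>(\<tau> :: nat \<Rightarrow> real) n. 0 \<le> \<tau> 0 \<and> strict_mono_on {..n} \<tau> \<longrightarrow>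
        prob_space.indep_vars M (\<lambda>_. count_space UNIV)
          (\<lambda>i \<omega>. if i = 0 then N (\<tau> 0) \<omega> else N (\<tau> i) \<omega> - N (\<tau> (i - 1)) \<omega>) {..n})"

definition indep_of_process ::
    "'a measure \<Rightarrow> (real \<Rightarrow> 'a \<Rightarrow> nat) \<Rightarrow> (nat \<Rightarrow> 'a \<Rightarrow> real) \<Rightarrow> bool" where
  "indep_of_process M N V \<longleftrightarrow>
     prob_space.indep_var M
       (Pi\<^sub>M {0..} (\<lambda>_. count_space UNIV)) (\<lambda>\<omega>. \<lambda>t\<in>{0..}. N t \<omega>)
       (Pi\<^sub>M {1..} (\<lambda>_. borel)) (\<lambda>\<omega>. \<lambda>j\<in>{1..}. V j \<omega>)"

definition random_sum ::
    "(real \<Rightarrow> 'a \<Rightarrow> nat) \<Rightarrow> (nat \<Rightarrow> 'a \<Rightarrow> real) \<Rightarrow> (real \<Rightarrow> real) \<Rightarrow> real \<Rightarrow> 'a \<Rightarrow> real" where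
  "random_sum N V \<mu> t \<omega> = (\<Sum>j = 1..N 1 \<omega>. \<mu> (t - V j \<omega>))"

(* Real exponents; meaningful for z > 0. *)
definition gen_fun :: "'a measure \<Rightarrow> ('a \<Rightarrow> real) \<Rightarrow> real \<Rightarrow> real" where
  "gen_fun M X z = (LINT \<omega>|M. z powr X \<omega>)"

definition joint_gen_fun ::
    "'a measure \<Rightarrow> ('a \<Rightarrow> real) \<Rightarrow> ('a \<Rightarrow> real) \<Rightarrow> real \<Rightarrow> real \<Rightarrow> real" where
  "joint_gen_fun M X Y z1 z2 = (LINT \<omega>|M. z1 powr X \<omega> * z2 powr Y \<omega>)"

(* rGamma is 1/Gamma, equal to 0 at the poles of Gamma. *)
definition H_fun :: "real measure \<Rightarrow> (real \<Rightarrow> real) \<Rightarrow> real \<Rightarrow> real \<Rightarrow> nat \<Rightarrow> real \<Rightarrow> real" where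
  "H_fun \<Lambda> \<mu> t s j z =
     (LINT v:{0..1}|\<Lambda>. Gamma (\<mu> (t + s - v) + 1) * rGamma (\<mu> (t + s - v) + 1 - real j)
                        * z powr \<mu> (t - v))"

definition mixed_deriv :: "nat \<Rightarrow> nat \<Rightarrow> (real \<Rightarrow> real \<Rightarrow> real) \<Rightarrow> real \<Rightarrow> real \<Rightarrow> real" where
  "mixed_deriv k l F x y = (deriv ^^ k) (\<lambda>x'. (deriv ^^ l) (F x') y) x"

(* As deriv is total, existence of the derivatives has to be expressed separately. *)
fun times_differentiable_at :: "nat \<Rightarrow> (real \<Rightarrow> real) \<Rightarrow> real \<Rightarrow> bool" where
  "times_differentiable_at 0 f x \<longleftrightarrow> True"
| "times_differentiable_at (Suc n) f x \<longleftrightarrow>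
     (\<forall>\<^sub>F y in nhds x. times_differentiable_at n f y) \<and> (deriv ^^ n) f field_differentiable (at x)"

definition mixed_differentiable_at ::
    "nat \<Rightarrow> nat \<Rightarrow> (real \<Rightarrow> real \<Rightarrow> real) \<Rightarrow> real \<Rightarrow> real \<Rightarrow> bool" where
  "mixed_differentiable_at k l F x y \<longleftrightarrow>
     (\<forall>\<^sub>F x' in nhds x. times_differentiable_at l (F x') y) \<and>
     times_differentiable_at k (\<lambda>x'. (deriv ^^ l) (F x') y) x"

end

theory Submission
  imports Defs
begin

text \<open>
  Write \<open>a v = \<mu> (t - v)\<close> and \<open>b v = \<mu> (t + s - v)\<close>, which are bounded on \<open>[0,1]\<close>. Since the sums run
  over a Poisson number of i.i.d. points with law \<open>\<Lambda> / \<Lambda>[0,1]\<close>, the joint generating function is a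
  compound Poisson transform (\<open>compound_poisson_expectation\<close>, \<open>joint_gen_fun_random_sum\<close>):
  \<open>G x y = exp (K x y - \<Lambda>[0,1])\<close>, where \<open>K x y\<close> is the \<open>\<Lambda>\<close>-integral of \<open>x powr a v * y powr b v\<close>
  over \<open>[0,1]\<close>.

  Integrals of powers with bounded exponents may be differentiated under the integral sign any number
  of times (\<open>power_integral_higher_deriv\<close>). The derivatives bring down falling factorials of the
  exponents, which are the quotients of Gamma functions in the definition of \<open>H\<^sub>j\<close>
  (\<open>Gamma_rGamma_falling_factorial\<close>). This gives the formula for the derivatives of \<open>H\<^sub>j\<close>, and it
  shows that the \<open>j\<close>-th derivative of \<open>K x\<close> at \<open>y = 1\<close> is \<open>H\<^sub>j x\<close>.

  Differentiating the exponential (\<open>exp_power_integral_derivs\<close>) and writing \<open>GR x = G x 1\<close> yields,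
  for \<open>x > 0\<close>, that \<open>GR' = GR * H\<^sub>0'\<close>, that the first \<open>y\<close>-derivative of \<open>G\<close> at \<open>y = 1\<close> is
  \<open>D\<^sub>1 = GR * H\<^sub>1\<close>, and that the second one is \<open>D\<^sub>1 * H\<^sub>1 + GR * H\<^sub>2\<close>. The three recursions are
  Leibniz' rule (\<open>higher_deriv_mult_real\<close>) for these products. All functions involved are infinitely
  differentiable on the positive half line: this is clear for \<open>H\<^sub>j\<close>, passes to \<open>GR\<close> by the linear
  differential equation (\<open>times_differentiable_on_linear_ode\<close>), and then to the products.
\<close>

section \<open>Repeatedly differentiable functions on an open set\<close>

text \<open>Differentiability at a point is defined by recursion on neighbourhoods; on an open set it
  becomes a plain statement about the iterated derivatives, which is easier to compute with.\<close>

definition times_differentiable_on :: "nat \<Rightarrow> real set \<Rightarrow> (real \<Rightarrow> real) \<Rightarrow> bool" where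
  "times_differentiable_on n S f \<longleftrightarrow>
     (\<forall>k<n. \<forall>x\<in>S. (deriv ^^ k) f field_differentiable at x)"

lemma times_differentiable_on_imp_at:
  assumes "open S" "times_differentiable_on n S f" "x \<in> S"
  shows "times_differentiable_at n f x"
  using assms(2,3)
proof (induction n arbitrary: x)
  case (Suc n)
  have "times_differentiable_on n S f"
    using Suc.prems(1) by (simp add: times_differentiable_on_def)
  then have "\<forall>\<^sub>F y in nhds x. times_differentiable_at n f y"
    using Suc.IH Suc.prems(2) assms(1) eventually_nhds by blast
  then show ?case
    using Suc.prems by (simp add: times_differentiable_on_def)
qed simp

lemma higher_deriv_cong_open:
  fixes f g :: "real \<Rightarrow> real"
  assumes "open S" "\<And>y. y \<in> S \<Longrightarrow> f y = g y" "x \<in> S"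
  shows "(deriv ^^ k) f x = (deriv ^^ k) g x"
  using assms by (intro higher_deriv_cong_ev refl) (auto simp: eventually_nhds)

lemma times_differentiable_on_cong:
  assumes "open S" "\<And>y. y \<in> S \<Longrightarrow> f y = g y"
  shows "times_differentiable_on n S f \<longleftrightarrow> times_differentiable_on n S g"
proof -
  have "times_differentiable_on n S g"
    if "times_differentiable_on n S f" "\<And>y. y \<in> S \<Longrightarrow> f y = g y" for f g
    unfolding times_differentiable_on_def
  proof (intro allI impI ballI)
    fix k x assume "k < n" "x \<in> S"
    then have "(deriv ^^ k) f field_differentiable at x"
      using that(1) by (simp add: times_differentiable_on_def)
    then obtain d where "((deriv ^^ k) f has_field_derivative d) (at x)"
      unfolding field_differentiable_def by blast
    then have "((deriv ^^ k) g has_field_derivative d) (at x)"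
      by (rule has_field_derivative_transform_within_open[OF _ assms(1) \<open>x \<in> S\<close>])
         (use higher_deriv_cong_open[OF assms(1) that(2)] in auto)
    then show "(deriv ^^ k) g field_differentiable at x"
      by (auto simp: field_differentiable_def)
  qed
  from this[of f g] this[of g f] assms(2) show ?thesis by auto
qed

text \<open>Peeling off the innermost derivative rather than the outermost one is what the inductions on
  sums, products and differential equations below need.\<close>

lemma times_differentiable_on_Suc:
  "times_differentiable_on (Suc n) S f \<longleftrightarrow>
     (\<forall>x\<in>S. f field_differentiable at x) \<and> times_differentiable_on n S (deriv f)"
  by (auto simp: times_differentiable_on_def All_less_Suc2 funpow_Suc_right simp del: funpow.simps)

lemma times_differentiable_on_mono:
  "times_differentiable_on n S f \<Longrightarrow> m \<le> n \<Longrightarrow> times_differentiable_on m S f"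
  by (auto simp: times_differentiable_on_def)

lemma times_differentiable_on_SucI:
  assumes "open S" "\<And>x. x \<in> S \<Longrightarrow> (f has_field_derivative f' x) (at x)"
    and "times_differentiable_on n S f'"
  shows "times_differentiable_on (Suc n) S f"
proof -
  have "times_differentiable_on n S (deriv f)"
    using times_differentiable_on_cong[OF assms(1), of "deriv f" f'] assms DERIV_imp_deriv by blast
  then show ?thesis
    unfolding times_differentiable_on_Suc using assms(2) by (auto simp: field_differentiable_def)
qed

lemma times_differentiable_on_deriv:
  assumes "times_differentiable_on (Suc n) S f" "x \<in> S"
  shows "(f has_field_derivative deriv f x) (at x)"
  using assms by (simp add: times_differentiable_on_Suc field_differentiable_derivI)

lemma times_differentiable_on_add:
  assumes "open S" "times_differentiable_on n S f" "times_differentiable_on n S g"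
  shows "times_differentiable_on n S (\<lambda>x. f x + g x)"
  using assms(2,3)
proof (induction n arbitrary: f g)
  case (Suc n)
  then have "times_differentiable_on n S (\<lambda>x. deriv f x + deriv g x)"
    by (simp add: times_differentiable_on_Suc)
  then show ?case
    by (rule times_differentiable_on_SucI[OF assms(1), rotated])
       (intro derivative_intros times_differentiable_on_deriv[OF Suc.prems(1)]
          times_differentiable_on_deriv[OF Suc.prems(2)])
qed (simp add: times_differentiable_on_def)

lemma times_differentiable_on_mult:
  assumes "open S" "times_differentiable_on n S f" "times_differentiable_on n S g"
  shows "times_differentiable_on n S (\<lambda>x. f x * g x)"
  using assms(2,3)
proof (induction n arbitrary: f g)
  case (Suc n)
  then have "times_differentiable_on n S (\<lambda>x. deriv f x * g x + deriv g x * f x)"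
    by (intro times_differentiable_on_add[OF assms(1)] Suc.IH)
       (auto simp: times_differentiable_on_Suc intro: times_differentiable_on_mono[of "Suc n"] Suc.prems)
  then show ?case
    by (rule times_differentiable_on_SucI[OF assms(1), rotated])
       (intro DERIV_mult times_differentiable_on_deriv[OF Suc.prems(1)]
          times_differentiable_on_deriv[OF Suc.prems(2)])
qed (simp add: times_differentiable_on_def)

text \<open>Bootstrapping: if \<open>f\<close> is \<open>n\<close> times differentiable then so is its derivative \<open>f * g\<close>, hence
  \<open>f\<close> is \<open>n + 1\<close> times differentiable.\<close>

lemma times_differentiable_on_linear_ode:
  assumes "open S" "\<And>x. x \<in> S \<Longrightarrow> (f has_field_derivative f x * g x) (at x)"
    and "\<And>n. times_differentiable_on n S g"
  shows "times_differentiable_on n S f"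
proof (induction n)
  case (Suc n)
  then have "times_differentiable_on n S (\<lambda>x. f x * g x)"
    by (intro times_differentiable_on_mult assms)
  then show ?case
    using times_differentiable_on_SucI[of S f "\<lambda>x. f x * g x"] assms(1,2) by blast
qed (simp add: times_differentiable_on_def)

lemma higher_deriv_add_real:
  fixes f g :: "real \<Rightarrow> real"
  assumes "open S" "times_differentiable_on n S f" "times_differentiable_on n S g" "x \<in> S"
  shows "(deriv ^^ n) (\<lambda>x. f x + g x) x = (deriv ^^ n) f x + (deriv ^^ n) g x"
  using assms(2-)
proof (induction n arbitrary: x)
  case (Suc n)
  have *: "times_differentiable_on n S f" "times_differentiable_on n S g"
    using Suc.prems by (auto intro: times_differentiable_on_mono)
  have "((\<lambda>x. (deriv ^^ n) f x + (deriv ^^ n) g x) has_field_derivative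
          (deriv ^^ Suc n) f x + (deriv ^^ Suc n) g x) (at x)"
    using Suc.prems
    by (auto intro!: derivative_intros simp: times_differentiable_on_def field_differentiable_derivI)
  then have "((deriv ^^ n) (\<lambda>x. f x + g x) has_field_derivative
          (deriv ^^ Suc n) f x + (deriv ^^ Suc n) g x) (at x)"
    by (rule has_field_derivative_transform_within_open[OF _ assms(1) \<open>x \<in> S\<close>])
       (use Suc.IH * in auto)
  then show ?case by (simp add: DERIV_imp_deriv)
qed simp

text \<open>Leibniz' rule: differentiating the sum once more and shifting the index where the new
  derivative falls on \<open>f\<close>, Pascal's rule merges the two binomial coefficients.\<close>

lemma higher_deriv_mult_real:
  fixes f g :: "real \<Rightarrow> real"
  assumes "open S" "times_differentiable_on n S f" "times_differentiable_on n S g" "x \<in> S"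
  shows "(deriv ^^ n) (\<lambda>x. f x * g x) x =
           (\<Sum>k = 0..n. real (n choose k) * (deriv ^^ k) f x * (deriv ^^ (n - k)) g x)"
  using assms(2-)
proof (induction n arbitrary: x)
  case (Suc n)
  have *: "times_differentiable_on n S f" "times_differentiable_on n S g"
    using Suc.prems by (auto intro: times_differentiable_on_mono)
  have D: "((deriv ^^ k) f has_field_derivative (deriv ^^ Suc k) f x) (at x)"
          "((deriv ^^ k) g has_field_derivative (deriv ^^ Suc k) g x) (at x)" if "k \<le> n" for k
    using Suc.prems that by (auto simp: times_differentiable_on_def field_differentiable_derivI)
  have sumeq: "(\<Sum>k = 0..n. real (n choose k) *
        ((deriv ^^ Suc k) f x * (deriv ^^ (n - k)) g x + (deriv ^^ Suc (n - k)) g x * (deriv ^^ k) f x))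
      = (\<Sum>k = 0..Suc n. real (Suc n choose k) * (deriv ^^ k) f x * (deriv ^^ (Suc n - k)) g x)"
    (is "?L = ?R")
  proof -
    define F where "F k = (deriv ^^ k) f x" for k
    define G where "G k = (deriv ^^ k) g x" for k
    have "?R = F 0 * G (Suc n) + (\<Sum>k = 0..n. real (Suc n choose Suc k) * F (Suc k) * G (n - k))"
      by (simp only: F_def[symmetric] G_def[symmetric] sum.atLeast0_atMost_Suc_shift) simp
    also have "\<dots> = (\<Sum>k = 0..n. real (n choose k) * F (Suc k) * G (n - k))
                 + (F 0 * G (Suc n) + (\<Sum>k = 0..n. real (n choose Suc k) * F (Suc k) * G (n - k)))"
      by (simp add: sum.distrib ring_distribs)
    also have "F 0 * G (Suc n) + (\<Sum>k = 0..n. real (n choose Suc k) * F (Suc k) * G (n - k))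
             = (\<Sum>k = 0..Suc n. real (n choose k) * F k * G (Suc n - k))"
      by (simp only: sum.atLeast0_atMost_Suc_shift) simp
    also have "\<dots> = (\<Sum>k = 0..n. real (n choose k) * F k * G (Suc (n - k)))"
      by (simp add: Suc_diff_le)
    finally show ?thesis
      by (simp only: F_def[symmetric] G_def[symmetric] sum.distrib[symmetric])
         (simp add: algebra_simps sum.distrib)
  qed
  have "((\<lambda>x. \<Sum>k = 0..n. real (n choose k) * ((deriv ^^ k) f x * (deriv ^^ (n - k)) g x))
          has_field_derivative (\<Sum>k = 0..n. real (n choose k) *
        ((deriv ^^ Suc k) f x * (deriv ^^ (n - k)) g x + (deriv ^^ Suc (n - k)) g x * (deriv ^^ k) f x)))
        (at x)"
    by (intro DERIV_sum DERIV_cmult DERIV_mult D) auto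
  then have "((deriv ^^ n) (\<lambda>x. f x * g x) has_field_derivative
      (\<Sum>k = 0..Suc n. real (Suc n choose k) * (deriv ^^ k) f x * (deriv ^^ (Suc n - k)) g x)) (at x)"
    unfolding sumeq
    by (rule has_field_derivative_transform_within_open[OF _ assms(1) \<open>x \<in> S\<close>])
       (use Suc.IH * in \<open>auto simp: mult.assoc\<close>)
  then show ?case by (simp add: DERIV_imp_deriv del: sum.atLeast0_atMost_Suc)
qed simp

section \<open>Integrals of powers\<close>

text \<open>Differentiation under the integral sign. By the mean value inequality the difference quotients
  are dominated by the bound \<open>g\<close> of the derivatives, so dominated convergence applies along every
  sequence that tends to \<open>x\<close> inside the ball.\<close>

lemma has_field_derivative_lebesgue_integral:
  fixes f f' :: "real \<Rightarrow> 'a \<Rightarrow> real"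
  assumes "e > 0"
    and int: "\<And>y. y \<in> ball x e \<Longrightarrow> integrable Q (f y)"
    and der: "\<And>y v. y \<in> ball x e \<Longrightarrow> v \<in> space Q \<Longrightarrow> ((\<lambda>y. f y v) has_field_derivative f' y v) (at y)"
    and bnd: "\<And>y v. y \<in> ball x e \<Longrightarrow> v \<in> space Q \<Longrightarrow> \<bar>f' y v\<bar> \<le> g v"
    and g: "integrable Q g"
    and meas: "f' x \<in> borel_measurable Q"
  shows "((\<lambda>y. LINT v|Q. f y v) has_field_derivative (LINT v|Q. f' x v)) (at x)"
proof -
  have x: "x \<in> ball x e" using \<open>e > 0\<close> by simp
  have "((\<lambda>y. ((LINT v|Q. f y v) - (LINT v|Q. f x v)) / (y - x)) \<longlongrightarrow> (LINT v|Q. f' x v))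
          (at x within ball x e)"
    unfolding tendsto_at_iff_sequentially comp_def
  proof (intro allI impI)
    fix X :: "nat \<Rightarrow> real"
    assume X: "\<forall>i. X i \<in> ball x e - {x}" and lim: "X \<longlonglongrightarrow> x"
    have "(\<lambda>i. LINT v|Q. (f (X i) v - f x v) / (X i - x)) \<longlonglongrightarrow> (LINT v|Q. f' x v)"
    proof (rule integral_dominated_convergence[where w = g])
      show "(\<lambda>v. (f (X i) v - f x v) / (X i - x)) \<in> borel_measurable Q" for i
        using int[of "X i"] int[OF x] X
        by (intro borel_measurable_divide borel_measurable_diff) auto
      show "AE v in Q. (\<lambda>i. (f (X i) v - f x v) / (X i - x)) \<longlonglongrightarrow> f' x v"
      proof (rule AE_I2)
        fix v assume v: "v \<in> space Q"
        have "((\<lambda>y. (f y v - f x v) / (y - x)) \<longlongrightarrow> f' x v) (at x)"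
          using der[OF x v] by (simp add: has_field_derivative_iff)
        then show "(\<lambda>i. (f (X i) v - f x v) / (X i - x)) \<longlonglongrightarrow> f' x v"
          using X lim unfolding tendsto_at_iff_sequentially comp_def by auto
      qed
      show "AE v in Q. norm ((f (X i) v - f x v) / (X i - x)) \<le> g v" for i
      proof (rule AE_I2)
        fix v assume v: "v \<in> space Q"
        have "norm (f (X i) v - f x v) \<le> g v * norm (X i - x)"
        proof (rule field_differentiable_bound[of "ball x e" "\<lambda>y. f y v" "\<lambda>y. f' y v"])
          show "((\<lambda>y. f y v) has_field_derivative f' z v) (at z within ball x e)"
            if "z \<in> ball x e" for z
            using der[OF that v] by (rule has_field_derivative_at_within)
        qed (use X x bnd v in auto)
        moreover have "X i \<noteq> x" using X by auto
        ultimately show "norm ((f (X i) v - f x v) / (X i - x)) \<le> g v"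
          by (simp add: field_simps)
      qed
    qed (use meas g in auto)
    moreover have "(LINT v|Q. (f (X i) v - f x v) / (X i - x))
        = ((LINT v|Q. f (X i) v) - (LINT v|Q. f x v)) / (X i - x)" for i
    proof -
      have "integrable Q (f (X i))" using X int by blast
      then show ?thesis using int[OF x] by simp
    qed
    ultimately show "(\<lambda>i. ((LINT v|Q. f (X i) v) - (LINT v|Q. f x v)) / (X i - x))
        \<longlonglongrightarrow> (LINT v|Q. f' x v)" by (simp only:)
  qed
  then show ?thesis
    by (simp add: has_field_derivative_iff at_within_open[OF x open_ball])
qed

text \<open>Both \<open>H\<^sub>j\<close> and the exponent of the joint generating function, as a function of either of its
  variables, have this form, with a bounded weight \<open>c\<close> and a bounded exponent \<open>a\<close>.\<close>

definition power_integral :: "'a measure \<Rightarrow> ('a \<Rightarrow> real) \<Rightarrow> ('a \<Rightarrow> real) \<Rightarrow> real \<Rightarrow> real" where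
  "power_integral Q c a z = (LINT v|Q. c v * z powr a v)"

definition bounded_measurable :: "'a measure \<Rightarrow> ('a \<Rightarrow> real) \<Rightarrow> bool" where
  "bounded_measurable Q f \<longleftrightarrow> f \<in> borel_measurable Q \<and> (\<exists>B. \<forall>v\<in>space Q. \<bar>f v\<bar> \<le> B)"

lemma bounded_measurable_const: "bounded_measurable Q (\<lambda>_. k)"
  by (auto simp: bounded_measurable_def)

lemma bounded_measurable_diff:
  assumes "bounded_measurable Q f" "bounded_measurable Q g"
  shows "bounded_measurable Q (\<lambda>v. f v - g v)"
proof -
  obtain B C where "\<forall>v\<in>space Q. \<bar>f v\<bar> \<le> B" "\<forall>v\<in>space Q. \<bar>g v\<bar> \<le> C"
    using assms by (auto simp: bounded_measurable_def)
  then have "\<forall>v\<in>space Q. \<bar>f v - g v\<bar> \<le> B + C"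
    by (auto intro: order_trans[OF abs_triangle_ineq4] add_mono)
  then show ?thesis using assms by (auto simp: bounded_measurable_def)
qed

lemma bounded_measurable_mult:
  assumes "bounded_measurable Q f" "bounded_measurable Q g"
  shows "bounded_measurable Q (\<lambda>v. f v * g v)"
proof -
  obtain B C where "\<forall>v\<in>space Q. \<bar>f v\<bar> \<le> B" "\<forall>v\<in>space Q. \<bar>g v\<bar> \<le> C"
    using assms by (auto simp: bounded_measurable_def)
  then have "\<forall>v\<in>space Q. \<bar>f v * g v\<bar> \<le> B * C"
    unfolding abs_mult by (metis abs_ge_zero mult_mono order_trans)
  then show ?thesis using assms by (auto simp: bounded_measurable_def)
qed

lemma bounded_measurable_powr:
  assumes "bounded_measurable Q a" "z > 0"
  shows "bounded_measurable Q (\<lambda>v. z powr a v)"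
proof -
  obtain B where B: "\<forall>v\<in>space Q. \<bar>a v\<bar> \<le> B"
    using assms by (auto simp: bounded_measurable_def)
  have "\<bar>z powr a v\<bar> \<le> exp (B * \<bar>ln z\<bar>)" if "v \<in> space Q" for v
  proof -
    have "a v * ln z \<le> \<bar>a v\<bar> * \<bar>ln z\<bar>" by (metis abs_ge_self abs_mult)
    also have "\<dots> \<le> B * \<bar>ln z\<bar>" using B that by (intro mult_right_mono) auto
    finally show ?thesis using \<open>z > 0\<close> by (simp add: powr_def)
  qed
  then show ?thesis using assms by (auto simp: bounded_measurable_def)
qed

lemma bounded_measurable_prod:
  assumes "\<And>i. i \<in> I \<Longrightarrow> bounded_measurable Q (f i)"
  shows "bounded_measurable Q (\<lambda>v. \<Prod>i\<in>I. f i v)"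
  using assms
  by (induction I rule: infinite_finite_induct)
     (auto intro!: bounded_measurable_const bounded_measurable_mult)

lemma bounded_measurable_integrable:
  assumes "finite_measure Q" "bounded_measurable Q f"
  shows "integrable Q f"
proof -
  interpret finite_measure Q by fact
  obtain B where "\<forall>v\<in>space Q. \<bar>f v\<bar> \<le> B"
    using assms by (auto simp: bounded_measurable_def)
  then show ?thesis
    using assms(2) by (intro integrable_const_bound[of _ B]) (auto simp: bounded_measurable_def)
qed

lemma power_integral_has_field_derivative:
  assumes Q: "finite_measure Q" and c: "bounded_measurable Q c" and a: "bounded_measurable Q a"
    and "z > 0"
  shows "(power_integral Q c a has_field_derivative
           power_integral Q (\<lambda>v. c v * a v) (\<lambda>v. a v - 1) z) (at z)"
  unfolding power_integral_def
proof (rule has_field_derivative_lebesgue_integral[of "z / 2"])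
  note bm = bounded_measurable_mult bounded_measurable_powr bounded_measurable_diff
    bounded_measurable_const c a
  have pos: "y > 0" if "y \<in> ball z (z / 2)" for y
    using that by (auto simp: dist_real_def abs_if split: if_splits)
  show "integrable Q (\<lambda>v. c v * y powr a v)" if "y \<in> ball z (z / 2)" for y
    using pos[OF that] by (intro bounded_measurable_integrable Q bm)
  show "((\<lambda>y. c v * y powr a v) has_field_derivative c v * a v * y powr (a v - 1)) (at y)"
    if "y \<in> ball z (z / 2)" for y v
    using pos[OF that] by (auto intro!: derivative_eq_intros)
  \<comment> \<open>On an interval, a power with a fixed exponent attains its maximum at an end point.\<close>
  show "\<bar>c v * a v * y powr (a v - 1)\<bar>
        \<le> \<bar>c v * a v\<bar> * ((z / 2) powr (a v - 1) + (2 * z) powr (a v - 1))"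
    if y: "y \<in> ball z (z / 2)" for y v
  proof -
    have y': "z / 2 \<le> y" "y \<le> 2 * z"
      using y by (auto simp: dist_real_def abs_if split: if_splits)
    have "y powr (a v - 1) \<le> (z / 2) powr (a v - 1) + (2 * z) powr (a v - 1)"
    proof (cases "a v \<ge> 1")
      case True
      then have "y powr (a v - 1) \<le> (2 * z) powr (a v - 1)"
        using y' \<open>z > 0\<close> by (intro powr_mono2) auto
      then show ?thesis by (smt (verit) powr_ge_zero)
    next
      case False
      then have "y powr (a v - 1) \<le> (z / 2) powr (a v - 1)"
        using y' \<open>z > 0\<close> by (intro powr_mono2') auto
      then show ?thesis by (smt (verit) powr_ge_zero)
    qed
    then show ?thesis unfolding abs_mult by (auto intro!: mult_left_mono)
  qed
  have "integrable Q (\<lambda>v. (c v * a v) * (z / 2) powr (a v - 1))"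
    "integrable Q (\<lambda>v. (c v * a v) * (2 * z) powr (a v - 1))"
    using \<open>z > 0\<close> by (intro bounded_measurable_integrable Q bm; simp)+
  then have "integrable Q (\<lambda>v. \<bar>(c v * a v) * (z / 2) powr (a v - 1)\<bar> + \<bar>(c v * a v) * (2 * z) powr (a v - 1)\<bar>)"
    by (intro Bochner_Integration.integrable_add integrable_abs)
  then show "integrable Q (\<lambda>v. \<bar>c v * a v\<bar> * ((z / 2) powr (a v - 1) + (2 * z) powr (a v - 1)))"
    by (simp add: abs_mult algebra_simps)
  show "(\<lambda>v. c v * a v * z powr (a v - 1)) \<in> borel_measurable Q"
    using c a by (auto simp: bounded_measurable_def)
qed (use \<open>z > 0\<close> in auto)

text \<open>Power integrals are closed under differentiation, so the integrand can be differentiated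
  repeatedly: each step contributes one more factor of a falling factorial.\<close>

lemma power_integral_higher_deriv:
  assumes Q: "finite_measure Q" and c: "bounded_measurable Q c" and a: "bounded_measurable Q a"
  shows "z > 0 \<Longrightarrow> (deriv ^^ n) (power_integral Q c a) z =
           power_integral Q (\<lambda>v. c v * (\<Prod>i<n. a v - real i)) (\<lambda>v. a v - real n) z"
    and "times_differentiable_on n {0<..} (power_integral Q c a)"
proof -
  have c': "bounded_measurable Q (\<lambda>v. c v * (\<Prod>i<n. a v - real i))" for n
    by (intro bounded_measurable_mult bounded_measurable_prod bounded_measurable_diff
        bounded_measurable_const c a)
  have a': "bounded_measurable Q (\<lambda>v. a v - real n)" for n
    by (intro bounded_measurable_diff bounded_measurable_const a)
  have D: "(power_integral Q (\<lambda>v. c v * (\<Prod>i<n. a v - real i)) (\<lambda>v. a v - real n)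
      has_field_derivative power_integral Q (\<lambda>v. c v * (\<Prod>i<Suc n. a v - real i))
        (\<lambda>v. a v - real (Suc n)) z) (at z)" if "z > 0" for n z
    using power_integral_has_field_derivative[OF Q c' a' that, of n n]
    by (simp add: mult.assoc algebra_simps)
  have *: "\<forall>z>0. (deriv ^^ n) (power_integral Q c a) z =
           power_integral Q (\<lambda>v. c v * (\<Prod>i<n. a v - real i)) (\<lambda>v. a v - real n) z" for n
  proof (induction n)
    case (Suc n)
    show ?case
    proof (intro allI impI)
      fix z :: real assume "z > 0"
      have "((deriv ^^ n) (power_integral Q c a) has_field_derivative
          power_integral Q (\<lambda>v. c v * (\<Prod>i<Suc n. a v - real i)) (\<lambda>v. a v - real (Suc n)) z) (at z)"
        by (rule has_field_derivative_transform_within_open[OF D[OF \<open>z > 0\<close>], of "{0<..}"])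
           (use Suc.IH \<open>z > 0\<close> in auto)
      then show "(deriv ^^ Suc n) (power_integral Q c a) z = 
          power_integral Q (\<lambda>v. c v * (\<Prod>i<Suc n. a v - real i)) (\<lambda>v. a v - real (Suc n)) z"
        by (simp add: DERIV_imp_deriv)
    qed
  qed (simp add: power_integral_def)
  show "(deriv ^^ n) (power_integral Q c a) z =
           power_integral Q (\<lambda>v. c v * (\<Prod>i<n. a v - real i)) (\<lambda>v. a v - real n) z"
    if "z > 0"
    using * that by blast
  show "times_differentiable_on n {0<..} (power_integral Q c a)"
    unfolding times_differentiable_on_def
  proof (intro allI impI ballI)
    fix k and z :: real assume "z \<in> {0<..}"
    then have "((deriv ^^ k) (power_integral Q c a) has_field_derivative
          power_integral Q (\<lambda>v. c v * (\<Prod>i<Suc k. a v - real i)) (\<lambda>v. a v - real (Suc k)) z) (at z)"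
      by (intro has_field_derivative_transform_within_open[OF D, of z "{0<..}"])
         (use * in auto)
    then show "(deriv ^^ k) (power_integral Q c a) field_differentiable at z"
      by (auto simp: field_differentiable_def)
  qed
qed

text \<open>By induction on \<open>n\<close> from \<open>z / \<Gamma>(z + 1) = 1 / \<Gamma>(z)\<close>, an identity of the entire function
  \<open>1 / \<Gamma>\<close> that persists at the poles of \<open>\<Gamma>\<close>; only \<open>\<Gamma>(x + 1)\<close> itself has to be finite.\<close>

lemma Gamma_rGamma_falling_factorial:
  fixes x :: real
  assumes "x \<ge> 0"
  shows "Gamma (x + 1) * rGamma (x + 1 - real n) = (\<Prod>i<n. x - real i)"
proof (induction n)
  case 0
  then show ?case using assms Gamma_real_pos[of "x + 1"]
    by (auto simp: rGamma_inverse_Gamma simp del: Gamma_real_pos)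
next
  case (Suc n)
  have "rGamma (x + 1 - real (Suc n)) = (x - real n) * rGamma (x + 1 - real n)"
    using rGamma_plus1[of "x - real n"] by (simp add: algebra_simps)
  then have "Gamma (x + 1) * rGamma (x + 1 - real (Suc n))
      = Gamma (x + 1) * rGamma (x + 1 - real n) * (x - real n)"
    by simp
  then show ?case by (simp only: Suc.IH) simp
qed

section \<open>The generating functional of a compound Poisson sum\<close>

lemma (in prob_space) indep_var_nn_integral:
  fixes X Y :: "'a \<Rightarrow> ennreal"
  assumes "indep_var borel X borel Y"
  shows "(\<integral>\<^sup>+\<omega>. X \<omega> * Y \<omega> \<partial>M) = (\<integral>\<^sup>+\<omega>. X \<omega> \<partial>M) * (\<integral>\<^sup>+\<omega>. Y \<omega> \<partial>M)"
proof -
  have "indep_vars (\<lambda>_. borel) (case_bool X Y) UNIV"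
    using assms unfolding indep_var_def
    by (rule back_subst[of "\<lambda>B. indep_vars B (case_bool X Y) UNIV"]) (auto split: bool.split)
  from indep_vars_nn_integral[OF _ this] show ?thesis
    by (simp add: UNIV_bool mult.commute)
qed

text \<open>Conditioning on the number \<open>K\<close> of factors turns the expectation into
  \<open>\<Sum>n. P(K = n) * m\<^sup>n\<close>, the exponential series. The computation is done with nonnegative integrals,
  where exchanging sum and integral is free. The independence of the variable \<open>K\<close> and the sequence
  \<open>V\<close> is expressed through numerical functions of each, because \<open>indep_var\<close> compares variables with
  values in one common type.\<close>

lemma (in prob_space) compound_poisson_expectation:
  fixes V :: "nat \<Rightarrow> 'a \<Rightarrow> real" and K :: "'a \<Rightarrow> nat" and w :: "real \<Rightarrow> real"
  assumes K: "distr M (count_space UNIV) K = measure_pmf (poisson_pmf r)" and "r > 0"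
    and V: "indep_vars (\<lambda>_. borel) V {1..}"
    and K_meas [measurable]: "K \<in> measurable M (count_space UNIV)"
    and KV: "\<And>n P. P \<in> borel_measurable (Pi\<^sub>M {1..} (\<lambda>_. borel)) \<Longrightarrow>
        indep_var borel (\<lambda>\<omega>. indicator {n} (K \<omega>) :: ennreal) borel (\<lambda>\<omega>. P (\<lambda>j\<in>{1..}. V j \<omega>))"
    and w_meas [measurable]: "w \<in> borel_measurable borel" and w0: "\<And>v. w v \<ge> 0"
    and m: "\<And>j. j \<ge> 1 \<Longrightarrow> (\<integral>\<^sup>+\<omega>. ennreal (w (V j \<omega>)) \<partial>M) = ennreal m" and "m \<ge> 0"
  shows "expectation (\<lambda>\<omega>. \<Prod>j = 1..K \<omega>. w (V j \<omega>)) = exp (r * (m - 1))"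
proof -
  have V_meas [measurable]: "V j \<in> borel_measurable M" if "j \<in> {1..}" for j
    using V that by (simp add: indep_vars_def)
  have prod_meas: "(\<lambda>\<omega>. \<Prod>j = 1..n. w (V j \<omega>)) \<in> borel_measurable M" for n
    by measurable
  have summand: "(\<integral>\<^sup>+\<omega>. indicator {n} (K \<omega>) * ennreal (\<Prod>j = 1..n. w (V j \<omega>)) \<partial>M)
      = ennreal (exp (- r) * ((r * m) ^ n / fact n))" for n
  proof -
    have "indep_var borel (\<lambda>\<omega>. indicator {n} (K \<omega>) :: ennreal) borel
        (\<lambda>\<omega>. \<Prod>i = 1..n. ennreal (w ((\<lambda>j\<in>{1..}. V j \<omega>) i)))"
      by (rule KV[of "\<lambda>f. \<Prod>i = 1..n. ennreal (w (f i))" n])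
        (auto intro!: borel_measurable_prod_ennreal measurable_compose[OF _ measurable_ennreal]
          measurable_compose[OF _ w_meas] measurable_component_singleton)
    then have "(\<integral>\<^sup>+\<omega>. indicator {n} (K \<omega>) * ennreal (\<Prod>j = 1..n. w (V j \<omega>)) \<partial>M)
        = (\<integral>\<^sup>+\<omega>. indicator {n} (K \<omega>) \<partial>M) * (\<integral>\<^sup>+\<omega>. (\<Prod>j = 1..n. ennreal (w (V j \<omega>))) \<partial>M)"
      by (auto dest!: indep_var_nn_integral simp: comp_def prod_ennreal w0)
    also have "(\<integral>\<^sup>+\<omega>. indicator {n} (K \<omega>) \<partial>M) = emeasure (distr M (count_space UNIV) K) {n}"
      by (simp add: nn_integral_distr[symmetric] flip: nn_integral_indicator)
    also have "\<dots> = ennreal (r ^ n / fact n * exp (- r))"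
      using \<open>r > 0\<close> by (simp add: K emeasure_pmf_single)
    also have "(\<integral>\<^sup>+\<omega>. (\<Prod>j = 1..n. ennreal (w (V j \<omega>))) \<partial>M)
        = (\<Prod>j = 1..n. \<integral>\<^sup>+\<omega>. ennreal (w (V j \<omega>)) \<partial>M)"
    proof (rule indep_vars_nn_integral)
      have "indep_vars (\<lambda>_. borel) V {1..n}"
        using V by (rule indep_vars_subset) auto
      then show "indep_vars (\<lambda>_. borel) (\<lambda>j \<omega>. ennreal (w (V j \<omega>))) {1..n}"
        by (rule indep_vars_compose2) measurable
    qed auto
    also have "\<dots> = ennreal (m ^ n)"
      using \<open>m \<ge> 0\<close> by (simp add: m ennreal_power)
    finally show ?thesis
      using \<open>m \<ge> 0\<close> \<open>r > 0\<close> by (simp add: ennreal_mult[symmetric] power_mult_distrib field_simps)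
  qed
  have "(\<integral>\<^sup>+\<omega>. ennreal (\<Prod>j = 1..K \<omega>. w (V j \<omega>)) \<partial>M)
      = (\<integral>\<^sup>+\<omega>. (\<Sum>n. indicator {n} (K \<omega>) * ennreal (\<Prod>j = 1..n. w (V j \<omega>))) \<partial>M)"
  proof (rule nn_integral_cong)
    fix \<omega>
    have "(\<Sum>n. ennreal (\<Prod>j = 1..n. w (V j \<omega>)) * indicator {n} (K \<omega>))
        = ennreal (\<Prod>j = 1..K \<omega>. w (V j \<omega>))"
      by (rule suminf_cmult_indicator) (auto simp: disjoint_family_on_def)
    then show "ennreal (\<Prod>j = 1..K \<omega>. w (V j \<omega>))
        = (\<Sum>n. indicator {n} (K \<omega>) * ennreal (\<Prod>j = 1..n. w (V j \<omega>)))"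
      by (simp add: mult.commute)
  qed
  also have "\<dots> = (\<Sum>n. ennreal (exp (- r) * ((r * m) ^ n / fact n)))"
  proof (subst nn_integral_suminf)
    show "(\<lambda>\<omega>. indicator {n} (K \<omega>) * ennreal (\<Prod>j = 1..n. w (V j \<omega>))) \<in> borel_measurable M" for n
      by (intro borel_measurable_times_ennreal measurable_compose[OF K_meas]
          measurable_compose[OF prod_meas measurable_ennreal]) auto
  qed (simp only: summand)
  also have "\<dots> = ennreal (exp (- r) * exp (r * m))"
    using exp_converges[of "r * m"] \<open>r > 0\<close> \<open>m \<ge> 0\<close>
    by (intro suminf_ennreal_eq sums_mult) (auto simp: field_simps)
  finally have "(\<integral>\<^sup>+\<omega>. ennreal (\<Prod>j = 1..K \<omega>. w (V j \<omega>)) \<partial>M) = ennreal (exp (r * (m - 1)))"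
    by (simp add: exp_add[symmetric] algebra_simps)
  moreover have "(\<lambda>\<omega>. \<Prod>j = 1..K \<omega>. w (V j \<omega>)) \<in> borel_measurable M"
    by (rule measurable_compose_countable[OF prod_meas K_meas])
  ultimately show ?thesis
    by (subst integral_eq_nn_integral) (auto intro: prod_nonneg w0)
qed


text \<open>The integrand of the generating function is the product of \<open>x powr \<mu> (t - v) * y powr \<mu> (u - v)\<close>
  over the points \<open>v = V j\<close>, whose mean under the law \<open>\<Lambda> / \<Lambda>[0,1]\<close> is the integral on the right-hand
  side divided by \<open>\<Lambda>[0,1]\<close>.\<close>

lemma joint_gen_fun_random_sum:
  assumes "prob_space M" and sets: "sets \<Lambda> = sets borel"
    and pos: "0 < emeasure \<Lambda> {0..1}" and fin: "emeasure \<Lambda> {0..1} < \<infinity>"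
    and N: "poisson_process M \<Lambda> N"
    and V: "prob_space.indep_vars M (\<lambda>_. borel) V {1..}"
    and V01: "\<And>j \<omega>. j \<ge> 1 \<Longrightarrow> \<omega> \<in> space M \<Longrightarrow> V j \<omega> \<in> {0..1}"
    and distr: "\<And>j. j \<ge> 1 \<Longrightarrow> distr M borel (V j) = uniform_measure \<Lambda> {0..1}"
    and NV: "indep_of_process M N V"
    and \<mu>: "continuous_on {0..} \<mu>" and "t \<ge> 1" "u \<ge> 1" and "x > 0" "y > 0"
  shows "joint_gen_fun M (random_sum N V \<mu> t) (random_sum N V \<mu> u) x y =
           exp ((LINT v:{0..1}|\<Lambda>. x powr \<mu> (t - v) * y powr \<mu> (u - v)) - measure \<Lambda> {0..1})"
proof -
  interpret prob_space M by fact
  define L where "L = measure \<Lambda> {0..1}"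
  have "emeasure \<Lambda> {0..1} = ennreal L"
    using fin by (simp add: L_def emeasure_eq_ennreal_measure)
  with pos have L: "emeasure \<Lambda> {0..1} = ennreal L" "L > 0"
    by (metis, metis ennreal_less_zero_iff)
  \<comment> \<open>\<open>\<mu>\<close> is only controlled on the half line, so the factor is cut off outside \<open>[0,1]\<close>.\<close>
  define w where "w v = indicator {0..1} v *\<^sub>R (x powr \<mu> (t - v) * y powr \<mu> (u - v))" for v
  have cont: "continuous_on {0..1} (\<lambda>v. x powr \<mu> (t - v) * y powr \<mu> (u - v))"
    using \<open>t \<ge> 1\<close> \<open>u \<ge> 1\<close> \<open>x > 0\<close> \<open>y > 0\<close>
    by (intro continuous_intros continuous_on_compose2[OF \<mu>]) auto
  have w_meas: "w \<in> borel_measurable borel"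
    unfolding w_def by (rule borel_measurable_continuous_on_indicator[OF _ cont]) auto
  then have w_meas' [measurable]: "w \<in> borel_measurable \<Lambda>"
    by (simp add: measurable_cong_sets[OF sets refl])
  have w0: "w v \<ge> 0" for v by (simp add: w_def)
  obtain B where "\<forall>v\<in>{0..1}. norm (x powr \<mu> (t - v) * y powr \<mu> (u - v)) \<le> B"
    using compact_imp_bounded[OF compact_continuous_image[OF cont compact_Icc]]
    by (auto simp: bounded_iff)
  then have B: "norm (w v) \<le> B * indicator {0..1} v" for v by (auto simp: w_def indicator_def)
  have w_int: "integrable \<Lambda> w"
  proof (rule Bochner_Integration.integrable_bound)
    show "integrable \<Lambda> (\<lambda>v. B * indicator {0..1} v)"
      using fin by (intro integrable_mult_right) (auto simp: sets)
    show "AE v in \<Lambda>. norm (w v) \<le> norm (B * indicator {0..1} v)"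
      using order_trans[OF B abs_ge_self] by (intro AE_I2) simp
  qed simp
  define m where "m = (LINT v|\<Lambda>. w v) / L"
  have m0: "m \<ge> 0" unfolding m_def using w0 L(2) by (simp add: integral_nonneg)
  have m: "(\<integral>\<^sup>+\<omega>. ennreal (w (V j \<omega>)) \<partial>M) = ennreal m" if "j \<ge> 1" for j
  proof -
    have Vj: "V j \<in> borel_measurable M" using V that by (simp add: indep_vars_def)
    have "(\<integral>\<^sup>+\<omega>. ennreal (w (V j \<omega>)) \<partial>M) = (\<integral>\<^sup>+v. ennreal (w v) \<partial>distr M borel (V j))"
      using Vj w_meas by (simp add: nn_integral_distr)
    also have "\<dots> = (\<integral>\<^sup>+v. ennreal (w v) * indicator {0..1} v \<partial>\<Lambda>) / emeasure \<Lambda> {0..1}"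
      unfolding distr[OF that]
      by (rule nn_integral_uniform_measure) (auto simp: sets)
    also have "(\<integral>\<^sup>+v. ennreal (w v) * indicator {0..1} v \<partial>\<Lambda>) = (\<integral>\<^sup>+v. ennreal (w v) \<partial>\<Lambda>)"
      by (intro nn_integral_cong) (auto simp: w_def indicator_def)
    also have "\<dots> = ennreal (LINT v|\<Lambda>. w v)"
      using w_int w0 by (intro nn_integral_eq_integral) auto
    finally show ?thesis
      using L w0 by (simp add: m_def divide_ennreal integral_nonneg)
  qed
  have KV: "indep_var borel (\<lambda>\<omega>. indicator {n} (N 1 \<omega>) :: ennreal) borel
      (\<lambda>\<omega>. P (\<lambda>j\<in>{1..}. V j \<omega>))"
    if "P \<in> borel_measurable (Pi\<^sub>M {1..} (\<lambda>_. borel))" for n P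
  proof -
    \<comment> \<open>In \<open>indep_of_process\<close> both paths have the type \<open>nat \<Rightarrow> real\<close>: the counting process enters
      through its real-valued restriction to integer times, of which time 1 is used here.\<close>
    have "(\<lambda>f. indicator {real n} (f 1) :: ennreal)
        \<in> borel_measurable (Pi\<^sub>M {0..} (\<lambda>_ :: nat. count_space UNIV))"
      by (rule measurable_compose[OF measurable_component_singleton]) auto
    from indep_var_compose[OF NV[unfolded indep_of_process_def] this that]
    show ?thesis by (simp add: comp_def indicator_def)
  qed
  have K_meas: "N 1 \<in> measurable M (count_space UNIV)"
    using N by (auto simp: poisson_process_def)
  have K: "distr M (count_space UNIV) (N 1) = measure_pmf (poisson_pmf L)"
    using N L(2) unfolding poisson_process_def L_def by (auto simp: poisson_law_def)
  have "joint_gen_fun M (random_sum N V \<mu> t) (random_sum N V \<mu> u) x y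
      = expectation (\<lambda>\<omega>. \<Prod>j = 1..N 1 \<omega>. w (V j \<omega>))"
    unfolding joint_gen_fun_def random_sum_def
  proof (rule Bochner_Integration.integral_cong)
    fix \<omega> assume "\<omega> \<in> space M"
    then have "w (V j \<omega>) = x powr \<mu> (t - V j \<omega>) * y powr \<mu> (u - V j \<omega>)" if "j \<ge> 1" for j
      using V01[OF that] by (simp add: w_def)
    then show "x powr (\<Sum>j = 1..N 1 \<omega>. \<mu> (t - V j \<omega>)) * y powr (\<Sum>j = 1..N 1 \<omega>. \<mu> (u - V j \<omega>))
        = (\<Prod>j = 1..N 1 \<omega>. w (V j \<omega>))"
      using \<open>x > 0\<close> \<open>y > 0\<close> by (simp add: powr_sum prod.distrib)
  qed simp
  also have "\<dots> = exp (L * (m - 1))"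
    by (rule compound_poisson_expectation[OF K L(2) V K_meas KV w_meas w0 m m0])
  also have "L * (m - 1) = (LINT v|\<Lambda>. w v) - L"
    using L(2) by (simp add: m_def field_simps)
  finally show ?thesis
    by (simp add: L_def w_def set_lebesgue_integral_def)
qed

section \<open>Derivatives of the joint generating function\<close>

text \<open>For fixed \<open>x\<close> write \<open>G x = exp (K - L)\<close> with a power integral \<open>K\<close>, so that \<open>G x\<close> solves the
  equation \<open>G' = G * K'\<close>. At \<open>y = 1\<close> the derivatives \<open>K'\<close> and \<open>K''\<close> are the integrals of \<open>x powr a\<close>
  weighted with falling factorials of \<open>b\<close>, whence \<open>h 1\<close> and \<open>h 2\<close>. The last claim is the same equation in the variable \<open>x\<close> along \<open>y = 1\<close>,
  where \<open>K\<close> is \<open>h 0\<close>.\<close>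

lemma exp_power_integral_derivs:
  fixes G :: "real \<Rightarrow> real \<Rightarrow> real" and a b :: "'a \<Rightarrow> real" and Q :: "'a measure"
  defines "h \<equiv> \<lambda>j. power_integral Q (\<lambda>v. \<Prod>i<j. b v - real i) a"
  assumes Q: "finite_measure Q" and a: "bounded_measurable Q a" and b: "bounded_measurable Q b"
    and G: "\<And>x y. x > 0 \<Longrightarrow> y > 0 \<Longrightarrow> G x y = exp ((LINT v|Q. x powr a v * y powr b v) - L)"
    and "x > 0"
  shows "times_differentiable_on n {0<..} (G x)"
    and "deriv (G x) 1 = G x 1 * h 1 x"
    and "deriv (deriv (G x)) 1 = G x 1 * h 1 x * h 1 x + G x 1 * h 2 x"
    and "((\<lambda>x. G x 1) has_field_derivative G x 1 * deriv (h 0) x) (at x)"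
proof -
  define K where "K = power_integral Q (\<lambda>v. x powr a v) b"
  have c: "bounded_measurable Q (\<lambda>v. x powr a v)"
    using a \<open>x > 0\<close> by (rule bounded_measurable_powr)
  have K: "times_differentiable_on n {0<..} K" for n
    unfolding K_def by (rule power_integral_higher_deriv(2)[OF Q c b])
  have K_deriv: "(K has_field_derivative deriv K y) (at y)"
    "(deriv K has_field_derivative deriv (deriv K) y) (at y)" if "y > 0" for y
    using that K[of 2] unfolding numeral_2_eq_2
    by (auto simp: times_differentiable_on_Suc field_differentiable_derivI)
  have K_1: "(deriv ^^ j) K 1 = h j x" for j
    unfolding K_def h_def
    by (subst power_integral_higher_deriv(1)[OF Q c b]) (simp_all add: power_integral_def mult.commute)
  have G_K: "G x y = exp (K y - L)" if "y > 0" for y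
    using G[OF \<open>x > 0\<close> that] by (simp add: K_def power_integral_def)
  have G_deriv: "(G x has_field_derivative G x y * deriv K y) (at y)" if "y > 0" for y
  proof -
    have "((\<lambda>y. exp (K y - L)) has_field_derivative G x y * deriv K y) (at y)"
      using that by (auto intro!: derivative_eq_intros K_deriv simp: G_K)
    then show ?thesis
      by (rule has_field_derivative_transform_within_open[of _ _ _ "{0<..}"]) (use that G_K in auto)
  qed
  have K': "times_differentiable_on n {0<..} (deriv K)" for n
    using K[of "Suc n"] by (simp add: times_differentiable_on_Suc)
  show "times_differentiable_on n {0<..} (G x)"
    by (rule times_differentiable_on_linear_ode[OF _ _ K']) (use G_deriv in auto)
  show "deriv (G x) 1 = G x 1 * h 1 x"
    using DERIV_imp_deriv[OF G_deriv[of 1]] K_1[of 1] by simp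
  have "((\<lambda>y. G x y * deriv K y) has_field_derivative
      G x 1 * deriv K 1 * deriv K 1 + deriv (deriv K) 1 * G x 1) (at 1)"
    by (intro DERIV_mult G_deriv K_deriv) auto
  then have "(deriv (G x) has_field_derivative
      G x 1 * deriv K 1 * deriv K 1 + deriv (deriv K) 1 * G x 1) (at 1)"
    by (rule has_field_derivative_transform_within_open[of _ _ _ "{0<..}"])
       (use DERIV_imp_deriv[OF G_deriv] in auto)
  then show "deriv (deriv (G x)) 1 = G x 1 * h 1 x * h 1 x + G x 1 * h 2 x"
    using K_1[of 1] K_1[of 2] by (simp add: DERIV_imp_deriv numeral_2_eq_2)
  have G_h: "G x 1 = exp (h 0 x - L)" if "x > 0" for x
    using G[OF that, of 1] by (simp add: h_def power_integral_def)
  have "times_differentiable_on (Suc 0) {0<..} (h 0)"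
    unfolding h_def by (rule power_integral_higher_deriv(2)[OF Q _ a]) (simp add: bounded_measurable_const)
  from times_differentiable_on_deriv[OF this] \<open>x > 0\<close>
  have "((\<lambda>x. exp (h 0 x - L)) has_field_derivative G x 1 * deriv (h 0) x) (at x)"
    by (auto intro!: derivative_eq_intros simp: G_h)
  then show "((\<lambda>x. G x 1) has_field_derivative G x 1 * deriv (h 0) x) (at x)"
    by (rule has_field_derivative_transform_within_open[of _ _ _ "{0<..}"])
       (use \<open>x > 0\<close> G_h in auto)
qed

theorem proposition2p8:
  fixes M :: "'a measure" and \<Lambda> :: "real measure"
    and N :: "real \<Rightarrow> 'a \<Rightarrow> nat" and V :: "nat \<Rightarrow> 'a \<Rightarrow> real"
    and \<mu> :: "real \<Rightarrow> real" and t s p :: real and n :: nat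
  defines "G \<equiv> joint_gen_fun M (random_sum N V \<mu> t) (random_sum N V \<mu> (t + s))"
    and "GR \<equiv> gen_fun M (random_sum N V \<mu> t)"
    and "H \<equiv> H_fun \<Lambda> \<mu> t s"
  assumes "prob_space M"
    and "locally_finite_on_half_line \<Lambda>"
    and "0 < emeasure \<Lambda> {0..1}" and "emeasure \<Lambda> {0..1} < \<infinity>"
    and "poisson_process M \<Lambda> N"
    and "continuous_on {0..} \<mu>" and "mono_on {0..} \<mu>"
    and "\<mu> 0 = 0" and "\<And>x. x > 0 \<Longrightarrow> \<mu> x > 0"
    and "prob_space.indep_vars M (\<lambda>_. borel) V {1..}"
    and "\<And>j \<omega>. j \<ge> 1 \<Longrightarrow> \<omega> \<in> space M \<Longrightarrow> V j \<omega> \<in> {0..1}"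
    and "\<And>j. j \<ge> 1 \<Longrightarrow> distr M borel (V j) = uniform_measure \<Lambda> {0..1}"
    and "indep_of_process M N V"
    and "t \<ge> 1" and "s > 0" and "0 < p" and "p < 1" and "n \<ge> 1"
  shows "(\<forall>j\<in>{0, 1, 2}. times_differentiable_at n (H j) p \<and>
            (deriv ^^ n) (H j) p =
              (LINT v:{0..1}|\<Lambda>. Gamma (\<mu> (t + s - v) + 1) * rGamma (\<mu> (t + s - v) + 1 - real j)
                 * (Gamma (\<mu> (t - v) + 1) * rGamma (\<mu> (t - v) + 1 - real n))
                 * p powr (\<mu> (t - v) - real n))) \<and>
         times_differentiable_at n GR p \<and>
         (\<forall>l\<in>{0, 1, 2}. mixed_differentiable_at n l G p 1) \<and>
         mixed_deriv n 0 G p 1 =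
           (\<Sum>k = 0..n - 1. real ((n - 1) choose k) * (deriv ^^ k) GR p * (deriv ^^ (n - k)) (H 0) p) \<and>
         mixed_deriv n 1 G p 1 =
           (\<Sum>k = 0..n. real (n choose k) * (deriv ^^ k) GR p * (deriv ^^ (n - k)) (H 1) p) \<and>
         mixed_deriv n 2 G p 1 =
           (\<Sum>k = 0..n. real (n choose k) *
              (mixed_deriv k 1 G p 1 * (deriv ^^ (n - k)) (H 1) p
               + (deriv ^^ k) GR p * (deriv ^^ (n - k)) (H 2) p))"
proof -
  define Q where "Q = restrict_space \<Lambda> {0..1}"
  define a where "a v = \<mu> (t - v)" for v
  define b where "b v = \<mu> (t + s - v)" for v
  define L where "L = measure \<Lambda> {0..1}"
  have sets: "sets \<Lambda> = sets borel"
    using \<open>locally_finite_on_half_line \<Lambda>\<close> by (simp add: locally_finite_on_half_line_def)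
  then have [simp]: "space \<Lambda> = UNIV" using sets_eq_imp_space_eq[OF sets] by simp
  have space_Q [simp]: "space Q = {0..1}" by (simp add: Q_def space_restrict_space)
  have Q: "finite_measure Q"
    using \<open>emeasure \<Lambda> {0..1} < \<infinity>\<close>
    by (intro finite_measureI) (simp add: Q_def sets emeasure_restrict_space space_restrict_space)
  have LINT_Q: "(LINT v:{0..1}|\<Lambda>. f v) = (LINT v|Q. f v)" for f :: "real \<Rightarrow> real"
    unfolding Q_def set_lebesgue_integral_def by (rule integral_restrict_space[symmetric]) (simp add: sets)
  have shift: "bounded_measurable Q (\<lambda>v. \<mu> (u - v))" if "u \<ge> 1" for u
  proof -
    have cont: "continuous_on {0..1} (\<lambda>v. \<mu> (u - v))"
      using that by (intro continuous_on_compose2[OF \<open>continuous_on {0..} \<mu>\<close>] continuous_intros) auto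
    then obtain B where "\<forall>v\<in>{0..1}. \<bar>\<mu> (u - v)\<bar> \<le> B"
      using compact_imp_bounded[OF compact_continuous_image[OF cont compact_Icc]]
      by (auto simp: bounded_iff)
    moreover have "(\<lambda>v. \<mu> (u - v)) \<in> borel_measurable Q"
      using borel_measurable_continuous_on_restrict[OF cont]
      by (simp add: Q_def measurable_cong_sets[OF sets_restrict_space_cong[OF sets] refl])
    ultimately show ?thesis by (auto simp: bounded_measurable_def)
  qed
  have a: "bounded_measurable Q a" and b: "bounded_measurable Q b"
    using shift[of t] shift[of "t + s"] \<open>t \<ge> 1\<close> \<open>s > 0\<close> by (simp_all add: a_def[abs_def] b_def[abs_def])
  have \<mu>_nonneg: "\<mu> r \<ge> 0" if "r \<ge> 0" for r
    using that \<open>\<mu> 0 = 0\<close> assms(12)[of r] by (cases "r = 0") auto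
  have ab_nonneg: "a v \<ge> 0" "b v \<ge> 0" if "v \<in> {0..1}" for v
    using that \<open>t \<ge> 1\<close> \<open>s > 0\<close> by (auto simp: a_def b_def intro!: \<mu>_nonneg)
  have G_exp: "G x y = exp ((LINT v|Q. x powr a v * y powr b v) - L)" if "x > 0" "y > 0" for x y
    using joint_gen_fun_random_sum[OF assms(4) sets assms(6-8) assms(13-16,9), of t "t + s" x y]
      that \<open>t \<ge> 1\<close> \<open>s > 0\<close>
    by (simp add: G_def LINT_Q L_def a_def b_def)
  have GR: "GR = (\<lambda>x. G x 1)"
    by (simp add: GR_def G_def gen_fun_def joint_gen_fun_def fun_eq_iff)
  have H: "H j = power_integral Q (\<lambda>v. \<Prod>i<j. b v - real i) a" for j
    unfolding H_def H_fun_def power_integral_def LINT_Q fun_eq_iff a_def[symmetric] b_def[symmetric]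
    using ab_nonneg
    by (intro allI Bochner_Integration.integral_cong) (auto simp: Gamma_rGamma_falling_factorial)
  have coeff: "bounded_measurable Q (\<lambda>v. \<Prod>i<j. b v - real i)" for j
    by (intro bounded_measurable_prod bounded_measurable_diff b bounded_measurable_const)
  have H_diff: "times_differentiable_on k {0<..} (H j)" for j k
    unfolding H by (rule power_integral_higher_deriv(2)[OF Q coeff a])
  have H_deriv: "(deriv ^^ n) (H j) p =
      (LINT v:{0..1}|\<Lambda>. Gamma (\<mu> (t + s - v) + 1) * rGamma (\<mu> (t + s - v) + 1 - real j)
         * (Gamma (\<mu> (t - v) + 1) * rGamma (\<mu> (t - v) + 1 - real n))
         * p powr (\<mu> (t - v) - real n))" for j
    unfolding H power_integral_higher_deriv(1)[OF Q coeff a \<open>0 < p\<close>]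
    unfolding power_integral_def LINT_Q a_def[symmetric] b_def[symmetric]
    using ab_nonneg
    by (intro Bochner_Integration.integral_cong) (auto simp: Gamma_rGamma_falling_factorial)
  note G_derivs = exp_power_integral_derivs[OF Q a b G_exp, folded H]
  have H0': "times_differentiable_on k {0<..} (deriv (H 0))" for k
    using H_diff[of "Suc k"] by (simp add: times_differentiable_on_Suc)
  have GR_deriv: "(GR has_field_derivative GR x * deriv (H 0) x) (at x)" if "x > 0" for x
    unfolding GR using G_derivs(4) that by blast
  have GR_diff: "times_differentiable_on k {0<..} GR" for k
    by (rule times_differentiable_on_linear_ode[OF _ _ H0']) (use GR_deriv in auto)
  \<comment> \<open>\<open>D l x\<close> is the \<open>l\<close>-th derivative in the second variable at \<open>1\<close>. For \<open>l = 1\<close> and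
    \<open>l = 2\<close> it is built from products of lower ones with the \<open>H j\<close>, ready for Leibniz' rule in \<open>x\<close>.\<close>
  define D where "D l x = (deriv ^^ l) (G x) 1" for l x
  have D0: "D 0 = GR" by (simp add: D_def GR fun_eq_iff)
  have D1: "D 1 x = GR x * H 1 x" if "x \<in> {0<..}" for x
    using G_derivs(2) that by (simp add: D_def GR)
  have D2: "D 2 x = D 1 x * H 1 x + GR x * H 2 x" if "x \<in> {0<..}" for x
    using G_derivs(3)[of x] D1[OF that] that by (simp add: D_def GR numeral_2_eq_2)
  have D1_diff: "times_differentiable_on k {0<..} (D 1)" for k
    using times_differentiable_on_cong[of "{0<..}" "D 1" "\<lambda>x. GR x * H 1 x", OF open_greaterThan D1]
    by (simp add: times_differentiable_on_mult GR_diff H_diff)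
  have D2_diff: "times_differentiable_on k {0<..} (D 2)" for k
    using times_differentiable_on_cong[of "{0<..}" "D 2" "\<lambda>x. D 1 x * H 1 x + GR x * H 2 x",
        OF open_greaterThan D2]
    by (simp add: times_differentiable_on_add times_differentiable_on_mult GR_diff H_diff D1_diff
        del: One_nat_def)
  have mixed: "mixed_deriv k l G p 1 = (deriv ^^ k) (D l) p" for k l
    by (simp add: mixed_deriv_def D_def[abs_def])
  have p: "p \<in> {0<..}" using \<open>0 < p\<close> by simp
  have at_p: "times_differentiable_at k f p" if "times_differentiable_on k {0<..} f" for k f
    using times_differentiable_on_imp_at[OF _ that p] by simp
  have "mixed_differentiable_at n l G p 1" if "l \<in> {0, 1, 2}" for l
  proof -
    have "\<forall>\<^sub>F x in nhds p. x \<in> {0<..}"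
      by (rule eventually_nhds_in_open[OF open_greaterThan p])
    then have "\<forall>\<^sub>F x in nhds p. times_differentiable_at l (G x) 1"
      by eventually_elim (use times_differentiable_on_imp_at[OF _ G_derivs(1)] in auto)
    moreover have "times_differentiable_on n {0<..} (D l)"
      using that GR_diff D1_diff D2_diff D0 by auto
    ultimately show ?thesis
      using at_p by (simp add: mixed_differentiable_at_def D_def[abs_def])
  qed
  moreover have "mixed_deriv n 0 G p 1 =
      (\<Sum>k = 0..n - 1. real ((n - 1) choose k) * (deriv ^^ k) GR p * (deriv ^^ (n - k)) (H 0) p)"
  proof -
    \<comment> \<open>The first derivative turns \<open>GR\<close> into a product, leaving \<open>n - 1\<close> derivatives for Leibniz' rule.\<close>
    obtain m where n: "n = Suc m" using \<open>n \<ge> 1\<close> by (cases n) auto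
    have "mixed_deriv n 0 G p 1 = (deriv ^^ m) (deriv GR) p"
      by (simp add: mixed D0 n funpow_Suc_right del: funpow.simps)
    also have "\<dots> = (deriv ^^ m) (\<lambda>x. GR x * deriv (H 0) x) p"
      by (rule higher_deriv_cong_open[OF open_greaterThan _ p]) (use GR_deriv DERIV_imp_deriv in auto)
    also have "\<dots> = (\<Sum>k = 0..m. real (m choose k) * (deriv ^^ k) GR p
                            * (deriv ^^ (m - k)) (deriv (H 0)) p)"
      by (rule higher_deriv_mult_real[OF open_greaterThan GR_diff H0' p])
    also have "\<dots> = (\<Sum>k = 0..m. real (m choose k) * (deriv ^^ k) GR p * (deriv ^^ (n - k)) (H 0) p)"
      by (intro sum.cong) (auto simp: n Suc_diff_le funpow_Suc_right simp del: funpow.simps)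
    finally show ?thesis by (simp add: n)
  qed
  moreover have "mixed_deriv n 1 G p 1 =
      (\<Sum>k = 0..n. real (n choose k) * (deriv ^^ k) GR p * (deriv ^^ (n - k)) (H 1) p)"
  proof -
    have "mixed_deriv n 1 G p 1 = (deriv ^^ n) (\<lambda>x. GR x * H 1 x) p"
      unfolding mixed by (rule higher_deriv_cong_open[OF open_greaterThan D1 p])
    also have "\<dots> = (\<Sum>k = 0..n. real (n choose k) * (deriv ^^ k) GR p * (deriv ^^ (n - k)) (H 1) p)"
      by (rule higher_deriv_mult_real[OF open_greaterThan GR_diff H_diff p])
    finally show ?thesis .
  qed
  moreover have "mixed_deriv n 2 G p 1 =
      (\<Sum>k = 0..n. real (n choose k) *
         (mixed_deriv k 1 G p 1 * (deriv ^^ (n - k)) (H 1) p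
          + (deriv ^^ k) GR p * (deriv ^^ (n - k)) (H 2) p))"
  proof -
    have "mixed_deriv n 2 G p 1 = (deriv ^^ n) (\<lambda>x. D 1 x * H 1 x + GR x * H 2 x) p"
      unfolding mixed by (rule higher_deriv_cong_open[OF open_greaterThan D2 p])
    also have "\<dots> = (deriv ^^ n) (\<lambda>x. D 1 x * H 1 x) p + (deriv ^^ n) (\<lambda>x. GR x * H 2 x) p"
      by (intro higher_deriv_add_real[OF open_greaterThan _ _ p]
          times_differentiable_on_mult[OF open_greaterThan] D1_diff GR_diff H_diff)
    also have "\<dots> = (\<Sum>k = 0..n. real (n choose k) * (deriv ^^ k) (D 1) p * (deriv ^^ (n - k)) (H 1) p)
        + (\<Sum>k = 0..n. real (n choose k) * (deriv ^^ k) GR p * (deriv ^^ (n - k)) (H 2) p)"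
      by (intro arg_cong2[of _ _ _ _ "(+)"] higher_deriv_mult_real[OF open_greaterThan _ _ p]
          D1_diff GR_diff H_diff)
    finally show ?thesis
      unfolding mixed by (simp only: sum.distrib ring_distribs mult.assoc)
  qed
  ultimately show ?thesis
    using H_deriv at_p[OF H_diff] at_p[OF GR_diff] by blast
qed

end
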